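(* Any quantum Frobenius datum $(R,\varepsilon,V,\beta)$ canonically induces a noncommutative Weyl algebra $(\mathcal P,\circ)$ generated by the operators $\{T_a,M_b: a,b\in V\}$ (equivalently, by $\{W(a,b):(a,b)\in V\oplus V\}$). Moreover, the commutation relations in $\mathcal P$ are uniquely determined by the Frobenius phase pairing, in the sense that the scalar commutators in $\mathcal P$ are exactly the values of the bicharacter $$\omega\big((a,b),(a',b')\big)=\varepsilon\big(\beta(b,a')-\beta(b',a)\big)\in\mathbb{C}^\times,$$ that is, $W(a,b)W(a',b')=\omega\big((a,b),(a',b')\big)\,W(a',b')W(a,b)$ for all $(a,b),(a',b')\in V\oplus V$, and hence admit no independent degrees of freedom beyond $(R,\varepsilon,V,\beta)$.
   Context: A quantum Frobenius datum $(R,\varepsilon,V,\beta)$ consists of a finite commutative Frobenius ring $R$ with generating character $\varepsilon:(R,+)\to\mathbb{C}^\times$, a finite free $R$-module $V=R^k$, and a perfect $R$-bilinear form $\beta:V\times V\to R$. Here a finite commutative ring $R$ is Frobenius with generating character $\varepsilon$ if $\varepsilon$ is an additive character such that $x\mapsto(y\mapsto\varepsilon(xy))$ is an isomorphism $R\to\widehat R$ of $R$-modules, where $\widehat R$ is the group of additive characters of $R$; and $\beta$ is perfect if the induced maps $V\to\mathrm{Hom}_R(V,R)$ are isomorphisms. The Frobenius phase pairing on $V$ is $\langle v,w\rangle_V=\varepsilon(\beta(v,w))$. $\mathrm{Fun}(V,\mathbb{C})$ is the space of functions $V\to\mathbb{C}$. For $a,b\in V$, the shift and phase operators on it are $(T_af)(x)=f(x-a)$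 and $(M_bf)(x)=\varepsilon(\beta(b,x))f(x)$, and $W(a,b)=T_aM_b$. The Weyl algebra $\mathcal P\subseteq\mathrm{End}_{\mathbb{C}}(\mathrm{Fun}(V,\mathbb{C}))$ is the unital $\mathbb{C}$-algebra generated by all $T_a$ and $M_b$, with multiplication $\circ$ given by composition of operators. The scalar commutator of two Weyl operators is $W(a,b)W(a',b')W(a,b)^{-1}W(a',b')^{-1}$.
   Formalization: Noncommutativity of the Weyl algebra is asserted only for V ≠ 0 (for V = 0 the algebra is ℂ, which is commutative); all other claims include V = 0. The ring R is taken to be nonzero (over the zero ring V = 0). *)

theory Defs
  imports Complex_Main "HOL-Library.Function_Algebras" "HOL-Library.Product_Plus"
begin

subsection \<open>Quantum Frobenius data\<close>

text \<open>The group of additive characters of a ring, written multiplicatively; as an \<open>R\<close>-module,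
  \<open>r\<close> acts on \<open>\<chi>\<close> by \<open>(r \<cdot> \<chi>) y = \<chi> (r * y)\<close>.\<close>

definition additive_characters :: "('r::comm_ring_1 \<Rightarrow> complex) set" where
  "additive_characters = {\<chi>. (\<forall>x. \<chi> x \<noteq> 0) \<and> (\<forall>x y. \<chi> (x + y) = \<chi> x * \<chi> y)}"

text \<open>The last two conjuncts say that the bijection is \<open>R\<close>-linear. They are consequences of
  \<open>\<epsilon>\<close> being a character.\<close>

definition generating_character :: "('r::comm_ring_1 \<Rightarrow> complex) \<Rightarrow> bool" where
  "generating_character \<epsilon> \<longleftrightarrow>
     \<epsilon> \<in> additive_characters \<and>
     (let \<Phi> = (\<lambda>x y. \<epsilon> (x * y)) in
        bij_betw \<Phi> UNIV additive_characters \<and>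
        (\<forall>x x'. \<Phi> (x + x') = (\<lambda>y. \<Phi> x y * \<Phi> x' y)) \<and>
        (\<forall>r x. \<Phi> (r * x) = (\<lambda>y. \<Phi> x (r * y))))"

text \<open>The free module \<open>V = R\<^sup>k\<close> is an \<open>R\<close>-module on a type \<open>'v\<close> that has a finite basis. The rank
  may be \<open>0\<close>. Bilinearity of \<open>\<beta>\<close> makes the two induced maps \<open>V \<rightarrow> Hom\<^sub>R(V, R)\<close> linear, so that being
  isomorphisms amounts to being bijective onto \<open>Hom\<^sub>R(V, R)\<close>.\<close>

locale quantum_frobenius_datum = module scale
  for scale :: "'r::{finite,comm_ring_1} \<Rightarrow> 'v::ab_group_add \<Rightarrow> 'v" +
  fixes \<epsilon> :: "'r \<Rightarrow> complex" and \<beta> :: "'v \<Rightarrow> 'v \<Rightarrow> 'r"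
  assumes generating: "generating_character \<epsilon>"
    and finite_free: "\<exists>B. finite B \<and> module.independent scale B \<and> module.span scale B = UNIV"
    and linear_left: "\<And>w. module_hom scale (*) (\<lambda>v. \<beta> v w)"
    and linear_right: "\<And>v. module_hom scale (*) (\<lambda>w. \<beta> v w)"
    and perfect_left: "bij_betw (\<lambda>v w. \<beta> v w) UNIV {\<phi>. module_hom scale (*) \<phi>}"
    and perfect_right: "bij_betw (\<lambda>w v. \<beta> v w) UNIV {\<phi>. module_hom scale (*) \<phi>}"

definition phase_pairing :: "('r \<Rightarrow> complex) \<Rightarrow> ('v \<Rightarrow> 'v \<Rightarrow> 'r) \<Rightarrow> 'v \<Rightarrow> 'v \<Rightarrow> complex" where
  "phase_pairing \<epsilon> \<beta> v w = \<epsilon> (\<beta> v w)"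

subsection \<open>Algebras of operators on \<open>Fun(V, \<complex>)\<close>\<close>

text \<open>Addition of functions, and hence of operators, is the pointwise one of
  \<^theory>\<open>HOL-Library.Function_Algebras\<close>; operators are multiplied by composition, never by \<open>(*)\<close>.\<close>

type_synonym 'v operator = "('v \<Rightarrow> complex) \<Rightarrow> ('v \<Rightarrow> complex)"

definition fun_scale :: "complex \<Rightarrow> ('v \<Rightarrow> complex) \<Rightarrow> ('v \<Rightarrow> complex)" where
  "fun_scale c f = (\<lambda>x. c * f x)"

definition op_scale :: "complex \<Rightarrow> 'v operator \<Rightarrow> 'v operator" where
  "op_scale c A = (\<lambda>f. fun_scale c (A f))"

definition unital_subalgebra :: "'v operator set \<Rightarrow> bool" where
  "unital_subalgebra S \<longleftrightarrow>
     S \<subseteq> {A. Vector_Spaces.linear fun_scale fun_scale A} \<and>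
     id \<in> S \<and>
     (\<forall>A\<in>S. \<forall>B\<in>S. A + B \<in> S) \<and>
     (\<forall>c. \<forall>A\<in>S. op_scale c A \<in> S) \<and>
     (\<forall>A\<in>S. \<forall>B\<in>S. A \<circ> B \<in> S)"

subsection \<open>The Weyl algebra\<close>

definition shift_op :: "'v::ab_group_add \<Rightarrow> 'v operator" where
  "shift_op a f = (\<lambda>x. f (x - a))"

definition phase_op :: "('r \<Rightarrow> complex) \<Rightarrow> ('v \<Rightarrow> 'v \<Rightarrow> 'r) \<Rightarrow> 'v \<Rightarrow> 'v operator" where
  "phase_op \<epsilon> \<beta> b f = (\<lambda>x. \<epsilon> (\<beta> b x) * f x)"

definition weyl_op :: "('r \<Rightarrow> complex) \<Rightarrow> ('v \<Rightarrow> 'v \<Rightarrow> 'r) \<Rightarrow> 'v \<times> 'v::ab_group_add \<Rightarrow> 'v operator" where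
  "weyl_op \<epsilon> \<beta> p = shift_op (fst p) \<circ> phase_op \<epsilon> \<beta> (snd p)"

definition weyl_algebra :: "('r \<Rightarrow> complex) \<Rightarrow> ('v \<Rightarrow> 'v::ab_group_add \<Rightarrow> 'r) \<Rightarrow> 'v operator set" where
  "weyl_algebra \<epsilon> \<beta> = unital_subalgebra hull (range shift_op \<union> range (phase_op \<epsilon> \<beta>))"

definition weyl_commutator ::
  "('r \<Rightarrow> complex) \<Rightarrow> ('v \<Rightarrow> 'v \<Rightarrow> 'r) \<Rightarrow> 'v \<times> 'v \<Rightarrow> 'v \<times> 'v::ab_group_add \<Rightarrow> 'v operator" where
  "weyl_commutator \<epsilon> \<beta> p q =
     weyl_op \<epsilon> \<beta> p \<circ> weyl_op \<epsilon> \<beta> q \<circ> inv (weyl_op \<epsilon> \<beta> p) \<circ> inv (weyl_op \<epsilon> \<beta> q)"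

definition weyl_form ::
  "('r::comm_ring_1 \<Rightarrow> complex) \<Rightarrow> ('v \<Rightarrow> 'v \<Rightarrow> 'r) \<Rightarrow> 'v \<times> 'v \<Rightarrow> 'v \<times> 'v \<Rightarrow> complex" where
  "weyl_form \<epsilon> \<beta> p q = \<epsilon> (\<beta> (snd p) (fst q) - \<beta> (snd q) (fst p))"

definition bicharacter :: "('g::ab_group_add \<Rightarrow> 'g \<Rightarrow> complex) \<Rightarrow> bool" where
  "bicharacter \<omega> \<longleftrightarrow>
     (\<forall>p q. \<omega> p q \<noteq> 0) \<and>
     (\<forall>p p' q. \<omega> (p + p') q = \<omega> p q * \<omega> p' q) \<and>
     (\<forall>p q q'. \<omega> p (q + q') = \<omega> p q * \<omega> p q')"

end

theory Submission
  imports Defs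
begin

text \<open>A Weyl operator sends \<open>f\<close> to \<open>x \<mapsto> \<epsilon> (\<beta> b (x - a)) * f (x - a)\<close>, so interchanging two of
  them changes the phase by the factor \<open>\<epsilon> (\<beta> b a' - \<beta> b' a)\<close>; everything depends on \<open>\<epsilon>\<close> and \<open>\<beta>\<close>
  only through the phase pairing. For \<open>v \<noteq> 0\<close>, perfectness yields \<open>b\<close> with \<open>\<beta> b v \<noteq> 0\<close>, and since
  \<open>\<epsilon>\<close> is generating, it is nontrivial on the ideal spanned by \<open>\<beta> b v\<close>. Hence the phase pairing is
  nondegenerate, and some shift fails to commute with some phase operator.\<close>

lemma vector_space_fun_scale: "vector_space fun_scale"
  by unfold_locales (auto simp: fun_scale_def algebra_simps fun_eq_iff)

lemma linear_operator_iff: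
  "Vector_Spaces.linear fun_scale fun_scale (A :: 'v operator) \<longleftrightarrow>
     (\<forall>f g. A (f + g) = A f + A g) \<and> (\<forall>c f. A (fun_scale c f) = fun_scale c (A f))"
  using vector_space_fun_scale by (auto simp: Vector_Spaces.linear_iff)

text \<open>This provides a member for the family that the hull intersects, whenever the generators
  are linear.\<close>

lemma unital_subalgebra_linear_operators:
  "unital_subalgebra {A :: 'v operator. Vector_Spaces.linear fun_scale fun_scale A}"
proof -
  interpret vector_space "fun_scale :: complex \<Rightarrow> ('v \<Rightarrow> complex) \<Rightarrow> 'v \<Rightarrow> complex"
    by (rule vector_space_fun_scale)
  show ?thesis
    by (auto simp: unital_subalgebra_def linear_operator_iff op_scale_def
        scale_right_distrib mult.commute add_ac)
qed

text \<open>The hypothesis matters: for a set containing a nonlinear operator the hull is an intersection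
  over the empty family, hence everything.\<close>

lemma unital_subalgebra_hull:
  assumes "S \<subseteq> {A :: 'v operator. Vector_Spaces.linear fun_scale fun_scale A}"
  shows "unital_subalgebra (unital_subalgebra hull S)"
proof -
  have "unital_subalgebra hull S \<subseteq> {A. Vector_Spaces.linear fun_scale fun_scale A}"
    using assms unital_subalgebra_linear_operators by (rule hull_minimal)
  \<comment> \<open>Containing \<open>id\<close> and the closure conditions pass to the intersection
    of any family, even the empty one.\<close>
  then show ?thesis
    unfolding unital_subalgebra_def by (auto simp: hull_def unital_subalgebra_def)
qed

lemma linear_shift_op: "Vector_Spaces.linear fun_scale fun_scale (shift_op a)"
  by (simp add: linear_operator_iff shift_op_def fun_scale_def fun_eq_iff)

lemma linear_phase_op: "Vector_Spaces.linear fun_scale fun_scale (phase_op \<epsilon> \<beta> b)"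
  by (simp add: linear_operator_iff phase_op_def fun_scale_def fun_eq_iff algebra_simps)

lemma weyl_generators_linear:
  "range shift_op \<union> range (phase_op \<epsilon> \<beta>) \<subseteq> {A. Vector_Spaces.linear fun_scale fun_scale A}"
  using linear_shift_op linear_phase_op by auto

lemma unital_subalgebra_weyl_algebra: "unital_subalgebra (weyl_algebra \<epsilon> \<beta>)"
  unfolding weyl_algebra_def by (rule unital_subalgebra_hull[OF weyl_generators_linear])

lemma shift_op_in_weyl_algebra: "shift_op a \<in> weyl_algebra \<epsilon> \<beta>"
  and phase_op_in_weyl_algebra: "phase_op \<epsilon> \<beta> b \<in> weyl_algebra \<epsilon> \<beta>"
  unfolding weyl_algebra_def by (auto intro: hull_inc)

lemma comp_in_weyl_algebra:
  "A \<in> weyl_algebra \<epsilon> \<beta> \<Longrightarrow> B \<in> weyl_algebra \<epsilon> \<beta> \<Longrightarrow> A \<circ> B \<in> weyl_algebra \<epsilon> \<beta>"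
  using unital_subalgebra_weyl_algebra[of \<epsilon> \<beta>] by (auto simp: unital_subalgebra_def)

lemma weyl_op_in_weyl_algebra: "weyl_op \<epsilon> \<beta> p \<in> weyl_algebra \<epsilon> \<beta>"
  unfolding weyl_op_def
  by (intro comp_in_weyl_algebra shift_op_in_weyl_algebra phase_op_in_weyl_algebra)

text \<open>The constant function 1 detects the scalar, so a scalar commutator determines a unique
  number. This works in rank \<open>0\<close> too, since \<open>V\<close> still has a point.\<close>

lemma op_scale_id_inject: "op_scale c id = (op_scale d id :: 'v operator) \<longleftrightarrow> c = d"
proof
  assume "op_scale c id = (op_scale d id :: 'v operator)"
  from fun_cong[OF this, of "\<lambda>_. 1"] show "c = d"
    by (simp add: op_scale_def fun_scale_def fun_eq_iff)
qed simp

lemma op_scale_comp: "op_scale c A \<circ> B = op_scale c (A \<circ> B)"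
  by (simp add: op_scale_def fun_eq_iff)

lemma shift_op_comp: "shift_op a \<circ> shift_op a' = shift_op (a + a')"
  by (simp add: shift_op_def fun_eq_iff algebra_simps)

lemma shift_op_0: "shift_op 0 = id"
  by (simp add: shift_op_def fun_eq_iff)

context quantum_frobenius_datum
begin

lemma \<epsilon>_nonzero: "\<epsilon> r \<noteq> 0"
  and \<epsilon>_add: "\<epsilon> (r + s) = \<epsilon> r * \<epsilon> s"
  using generating by (auto simp: generating_character_def additive_characters_def)

lemma \<epsilon>_0: "\<epsilon> 0 = 1"
  using \<epsilon>_add[of 0 0] \<epsilon>_nonzero[of 0] by simp

lemma \<epsilon>_diff: "\<epsilon> (r - s) = \<epsilon> r * inverse (\<epsilon> s)"
  using \<epsilon>_add[of "r - s" s] \<epsilon>_nonzero[of s] by (simp add: field_simps)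

lemmas \<beta>_add_left = module_hom.add[OF linear_left]
  and \<beta>_zero_left = module_hom.zero[OF linear_left]
  and \<beta>_scale_left = module_hom.scale[OF linear_left]
  and \<beta>_add_right = module_hom.add[OF linear_right]
  and \<beta>_diff_right = module_hom.diff[OF linear_right]
  and \<beta>_zero_right = module_hom.zero[OF linear_right]

lemma phase_op_comp: "phase_op \<epsilon> \<beta> b \<circ> phase_op \<epsilon> \<beta> b' = phase_op \<epsilon> \<beta> (b + b')"
  by (simp add: phase_op_def fun_eq_iff \<beta>_add_left \<epsilon>_add)

lemma phase_op_0: "phase_op \<epsilon> \<beta> 0 = id"
  by (simp add: phase_op_def fun_eq_iff \<beta>_zero_left \<epsilon>_0)

lemma weyl_op_zero_left: "weyl_op \<epsilon> \<beta> (0, b) = phase_op \<epsilon> \<beta> b"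
  by (simp add: weyl_op_def shift_op_0)

lemma weyl_op_zero_right: "weyl_op \<epsilon> \<beta> (a, 0) = shift_op a"
  by (simp add: weyl_op_def phase_op_0)

lemma weyl_algebra_eq_hull_weyl_op:
  "weyl_algebra \<epsilon> \<beta> = unital_subalgebra hull (range (weyl_op \<epsilon> \<beta>))"
proof (rule subset_antisym)
  \<comment> \<open>Linearity comes from membership in \<open>weyl_algebra\<close>; it makes the
    hull of the Weyl operators a unital subalgebra.\<close>
  have "range (weyl_op \<epsilon> \<beta>) \<subseteq> {A. Vector_Spaces.linear fun_scale fun_scale A}"
    using weyl_op_in_weyl_algebra unital_subalgebra_weyl_algebra
    by (fastforce simp: unital_subalgebra_def)
  then have "unital_subalgebra (unital_subalgebra hull (range (weyl_op \<epsilon> \<beta>)))"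
    by (rule unital_subalgebra_hull)
  moreover have "range shift_op \<union> range (phase_op \<epsilon> \<beta>) \<subseteq> unital_subalgebra hull (range (weyl_op \<epsilon> \<beta>))"
    by (auto intro!: hull_inc simp flip: weyl_op_zero_left weyl_op_zero_right)
  ultimately show "weyl_algebra \<epsilon> \<beta> \<subseteq> unital_subalgebra hull (range (weyl_op \<epsilon> \<beta>))"
    unfolding weyl_algebra_def by (metis hull_minimal)
  show "unital_subalgebra hull (range (weyl_op \<epsilon> \<beta>)) \<subseteq> weyl_algebra \<epsilon> \<beta>"
    by (rule hull_minimal) (auto simp: weyl_op_in_weyl_algebra unital_subalgebra_weyl_algebra)
qed

text \<open>The factors of \<open>W'\<close> stand in reversed order, so that the two inner factors
  cancel first. As a product of generators, \<open>W'\<close> also shows that the inverse lies in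
  the algebra.\<close>

lemma weyl_op_inverse:
  fixes p :: "'v \<times> 'v"
  defines "W' \<equiv> phase_op \<epsilon> \<beta> (- snd p) \<circ> shift_op (- fst p)"
  shows "weyl_op \<epsilon> \<beta> p \<circ> W' = id" and "W' \<circ> weyl_op \<epsilon> \<beta> p = id"
proof -
  have "weyl_op \<epsilon> \<beta> p \<circ> W' =
      shift_op (fst p) \<circ> (phase_op \<epsilon> \<beta> (snd p) \<circ> phase_op \<epsilon> \<beta> (- snd p)) \<circ> shift_op (- fst p)"
    by (simp add: W'_def weyl_op_def comp_assoc)
  then show "weyl_op \<epsilon> \<beta> p \<circ> W' = id"
    by (simp add: phase_op_comp phase_op_0 shift_op_comp shift_op_0)
  have "W' \<circ> weyl_op \<epsilon> \<beta> p =
      phase_op \<epsilon> \<beta> (- snd p) \<circ> (shift_op (- fst p) \<circ> shift_op (fst p)) \<circ> phase_op \<epsilon> \<beta> (snd p)"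
    by (simp add: W'_def weyl_op_def comp_assoc)
  then show "W' \<circ> weyl_op \<epsilon> \<beta> p = id"
    by (simp add: phase_op_comp phase_op_0 shift_op_comp shift_op_0)
qed

lemma bij_weyl_op: "bij (weyl_op \<epsilon> \<beta> p)"
  using weyl_op_inverse by (rule o_bij[rotated])

lemma inv_weyl_op_in_weyl_algebra: "inv (weyl_op \<epsilon> \<beta> p) \<in> weyl_algebra \<epsilon> \<beta>"
  unfolding inv_unique_comp[OF weyl_op_inverse]
  by (intro comp_in_weyl_algebra shift_op_in_weyl_algebra phase_op_in_weyl_algebra)

text \<open>This separates the difference inside \<epsilon> into two values of the pairing, which
  makes visible that the form depends on nothing else.\<close>

lemma weyl_form_eq:
  "weyl_form \<epsilon> \<beta> p q =
     phase_pairing \<epsilon> \<beta> (snd p) (fst q) * inverse (phase_pairing \<epsilon> \<beta> (snd q) (fst p))"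
  by (simp add: weyl_form_def phase_pairing_def \<epsilon>_diff)

lemma bicharacter_weyl_form: "bicharacter (weyl_form \<epsilon> \<beta>)"
  by (simp add: bicharacter_def weyl_form_eq phase_pairing_def \<epsilon>_nonzero \<epsilon>_add
      \<beta>_add_left \<beta>_add_right)

lemma weyl_op_commute:
  "weyl_op \<epsilon> \<beta> p \<circ> weyl_op \<epsilon> \<beta> q =
     op_scale (weyl_form \<epsilon> \<beta> p q) (weyl_op \<epsilon> \<beta> q \<circ> weyl_op \<epsilon> \<beta> p)"
proof (intro ext)
  fix f x
  obtain a b a' b' where [simp]: "p = (a, b)" "q = (a', b')"
    by (cases p, cases q)
  \<comment> \<open>These are the exponents of the phases collected in the two orders; only the
    cross terms differ.\<close>
  have "\<beta> b (x - a) + \<beta> b' (x - a - a') = (\<beta> b a' - \<beta> b' a) + (\<beta> b' (x - a') + \<beta> b (x - a' - a))"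
    by (simp add: \<beta>_diff_right)
  then have "\<epsilon> (\<beta> b (x - a)) * \<epsilon> (\<beta> b' (x - a - a')) =
      \<epsilon> (\<beta> b a' - \<beta> b' a) * (\<epsilon> (\<beta> b' (x - a')) * \<epsilon> (\<beta> b (x - a' - a)))"
    by (metis \<epsilon>_add)
  then show "(weyl_op \<epsilon> \<beta> p \<circ> weyl_op \<epsilon> \<beta> q) f x =
      op_scale (weyl_form \<epsilon> \<beta> p q) (weyl_op \<epsilon> \<beta> q \<circ> weyl_op \<epsilon> \<beta> p) f x"
    \<comment> \<open>The instance of \<open>add.commute\<close> identifies the points at which the
      two orders evaluate \<open>f\<close>.\<close>
    by (simp add: weyl_op_def shift_op_def phase_op_def op_scale_def fun_scale_def weyl_form_def
        diff_diff_eq add.commute[of a' a] flip: mult.assoc)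
qed

lemma weyl_commutator_eq: "weyl_commutator \<epsilon> \<beta> p q = op_scale (weyl_form \<epsilon> \<beta> p q) id"
proof -
  \<comment> \<open>Once the first two factors of the commutator are swapped, the inverses cancel
    from the inside out.\<close>
  have "weyl_op \<epsilon> \<beta> q \<circ> weyl_op \<epsilon> \<beta> p \<circ> inv (weyl_op \<epsilon> \<beta> p) \<circ> inv (weyl_op \<epsilon> \<beta> q) = id"
    using bij_weyl_op by (simp add: fun_eq_iff bij_is_surj surj_f_inv_f)
  then show ?thesis
    by (simp add: weyl_commutator_def weyl_op_commute[of p q] op_scale_comp)
qed

lemma weyl_commutator_eq_scalar_iff:
  "weyl_commutator \<epsilon> \<beta> p q = op_scale c id \<longleftrightarrow> c = weyl_form \<epsilon> \<beta> p q"
  by (auto simp: weyl_commutator_eq op_scale_id_inject)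

lemma phase_pairing_nondegenerate:
  assumes "v \<noteq> 0"
  shows "\<exists>b. phase_pairing \<epsilon> \<beta> b v \<noteq> 1"
proof -
  have "(\<lambda>b. \<beta> b v) \<noteq> (\<lambda>b. \<beta> b 0)"
    using assms bij_betw_imp_inj_on[OF perfect_right] by (auto dest: injD)
  then obtain b where b: "\<beta> b v \<noteq> 0"
    by (auto simp: \<beta>_zero_right)
  have inj: "inj (\<lambda>x y. \<epsilon> (x * y))"
    using generating by (auto simp: generating_character_def bij_betw_def Let_def)
  have "(\<lambda>y. \<epsilon> (\<beta> b v * y)) \<noteq> (\<lambda>y. \<epsilon> (0 * y))"
    using inj_eq[OF inj, of "\<beta> b v" 0] b by simp
  then obtain y where "\<epsilon> (\<beta> b v * y) \<noteq> 1"
    by (auto simp: \<epsilon>_0)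
  \<comment> \<open>Left linearity moves the multiplier \<open>y\<close> onto \<open>b\<close>,
    which turns nontriviality on the ideal into a value of the pairing.\<close>
  then have "phase_pairing \<epsilon> \<beta> (scale y b) v \<noteq> 1"
    by (simp add: phase_pairing_def \<beta>_scale_left mult.commute)
  then show ?thesis ..
qed

text \<open>The assumption excludes \<open>V = 0\<close>, where functions form a one-dimensional
  space and all linear operators commute.\<close>

lemma weyl_algebra_noncommutative:
  fixes v :: 'v
  assumes "v \<noteq> 0"
  shows "\<exists>A\<in>weyl_algebra \<epsilon> \<beta>. \<exists>B\<in>weyl_algebra \<epsilon> \<beta>. A \<circ> B \<noteq> B \<circ> A"
proof -
  obtain b where b: "phase_pairing \<epsilon> \<beta> b v \<noteq> 1"
    using phase_pairing_nondegenerate[OF assms] ..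
  \<comment> \<open>On the constant function 1 at the point \<open>v\<close>, one order yields the
    pairing of \<open>b\<close> with \<open>v\<close>, the other \<epsilon> at \<open>0\<close>,
    which is 1.\<close>
  have "(phase_op \<epsilon> \<beta> b \<circ> shift_op v) (\<lambda>_. 1) v \<noteq> (shift_op v \<circ> phase_op \<epsilon> \<beta> b) (\<lambda>_. 1) v"
    using b by (simp add: phase_op_def shift_op_def phase_pairing_def \<beta>_zero_right \<epsilon>_0)
  then have "phase_op \<epsilon> \<beta> b \<circ> shift_op v \<noteq> shift_op v \<circ> phase_op \<epsilon> \<beta> b"
    by metis
  then show ?thesis
    using phase_op_in_weyl_algebra shift_op_in_weyl_algebra by blast
qed

end

text \<open>Since \<open>shift_op\<close> involves neither \<epsilon> nor \<beta>, this carries over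
  to the Weyl operators and their algebra.\<close>

lemma phase_op_cong:
  assumes "phase_pairing \<epsilon>' \<beta>' = phase_pairing \<epsilon> \<beta>"
  shows "phase_op \<epsilon>' \<beta>' = phase_op \<epsilon> \<beta>"
  using assms by (simp add: phase_op_def phase_pairing_def fun_eq_iff)

theorem theorem6p1:
  fixes scale :: "'r::{finite,comm_ring_1} \<Rightarrow> 'v::ab_group_add \<Rightarrow> 'v"
    and \<epsilon> :: "'r \<Rightarrow> complex"
    and \<beta> :: "'v \<Rightarrow> 'v \<Rightarrow> 'r"
  assumes "quantum_frobenius_datum scale \<epsilon> \<beta>"
  shows
    "unital_subalgebra (weyl_algebra \<epsilon> \<beta>) \<and>
     weyl_algebra \<epsilon> \<beta> = unital_subalgebra hull (range (weyl_op \<epsilon> \<beta>)) \<and>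
     ((\<exists>v::'v. v \<noteq> 0) \<longrightarrow>
        (\<exists>A\<in>weyl_algebra \<epsilon> \<beta>. \<exists>B\<in>weyl_algebra \<epsilon> \<beta>. A \<circ> B \<noteq> B \<circ> A)) \<and>
     (\<forall>p. bij (weyl_op \<epsilon> \<beta> p) \<and> inv (weyl_op \<epsilon> \<beta> p) \<in> weyl_algebra \<epsilon> \<beta>) \<and>
     bicharacter (weyl_form \<epsilon> \<beta>) \<and>
     (\<forall>p q. weyl_op \<epsilon> \<beta> p \<circ> weyl_op \<epsilon> \<beta> q =
        op_scale (weyl_form \<epsilon> \<beta> p q) (weyl_op \<epsilon> \<beta> q \<circ> weyl_op \<epsilon> \<beta> p)) \<and>
     (\<forall>p q c. weyl_commutator \<epsilon> \<beta> p q = op_scale c id \<longleftrightarrow> c = weyl_form \<epsilon> \<beta> p q) \<and>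
     {c. \<exists>p q. weyl_commutator \<epsilon> \<beta> p q = op_scale c id} = {weyl_form \<epsilon> \<beta> p q |p q. True} \<and>
     (\<forall>a b a' b'. weyl_form \<epsilon> \<beta> (a, b) (a', b') =
        phase_pairing \<epsilon> \<beta> b a' * inverse (phase_pairing \<epsilon> \<beta> b' a)) \<and>
     (\<forall>\<epsilon>' \<beta>'. quantum_frobenius_datum scale \<epsilon>' \<beta>' \<and> phase_pairing \<epsilon>' \<beta>' = phase_pairing \<epsilon> \<beta> \<longrightarrow>
        weyl_op \<epsilon>' \<beta>' = weyl_op \<epsilon> \<beta> \<and>
        weyl_algebra \<epsilon>' \<beta>' = weyl_algebra \<epsilon> \<beta> \<and>
        weyl_form \<epsilon>' \<beta>' = weyl_form \<epsilon> \<beta>)"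
proof -
  interpret quantum_frobenius_datum scale \<epsilon> \<beta>
    by (rule assms)
  have "weyl_op \<epsilon>' \<beta>' = weyl_op \<epsilon> \<beta> \<and> weyl_algebra \<epsilon>' \<beta>' = weyl_algebra \<epsilon> \<beta> \<and>
      weyl_form \<epsilon>' \<beta>' = weyl_form \<epsilon> \<beta>"
    if "quantum_frobenius_datum scale \<epsilon>' \<beta>'" and eq: "phase_pairing \<epsilon>' \<beta>' = phase_pairing \<epsilon> \<beta>"
    for \<epsilon>' :: "'r \<Rightarrow> complex" and \<beta>' :: "'v \<Rightarrow> 'v \<Rightarrow> 'r"
  proof -
    \<comment> \<open>The form applies \<epsilon> to a difference, so equal pairings give equal
      forms only after \<open>weyl_form_eq\<close> is used for both data.\<close>
    have "weyl_form \<epsilon>' \<beta>' = weyl_form \<epsilon> \<beta>"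
      using quantum_frobenius_datum.weyl_form_eq[OF that(1)] weyl_form_eq eq
      by (simp add: fun_eq_iff)
    then show ?thesis
      by (simp add: weyl_op_def weyl_algebra_def phase_op_cong[OF eq] fun_eq_iff)
  qed
  moreover have "{c. \<exists>p q. weyl_commutator \<epsilon> \<beta> p q = op_scale c id} =
      {weyl_form \<epsilon> \<beta> p q |p q. True}"
    by (simp add: weyl_commutator_eq_scalar_iff)
  moreover have "weyl_form \<epsilon> \<beta> (a, b) (a', b') =
      phase_pairing \<epsilon> \<beta> b a' * inverse (phase_pairing \<epsilon> \<beta> b' a)" for a b a' b'
    by (simp add: weyl_form_eq)
  ultimately show ?thesis
    using unital_subalgebra_weyl_algebra weyl_algebra_eq_hull_weyl_op weyl_algebra_noncommutative
      bij_weyl_op inv_weyl_op_in_weyl_algebra bicharacter_weyl_form weyl_op_commute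
      weyl_commutator_eq_scalar_iff
    by (intro conjI allI impI) (assumption | blast)+
qed

end
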